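(* Let $(X,d)$ be a metric space and let $f\colon X\to[-\infty,+\infty]$ be a lower semicontinuous proper function that is bounded below and has the Kurdyka-{\L}ojasiewicz property for minimization, with desingularizer $\phi$. Let $\delta>0$. Then there exists $\varepsilon>0$ such that every sequence $(x_k)_{k\ge 0}$ in $X$ with $f(x_0)<\inf f+\varepsilon$ and satisfying the descent property $$f(x_k)-f(x_{k+1})\ \ge\ \delta\,\big(|\overline{\nabla} f|(x_{k+1})\big)^2\qquad\text{for all } k\ge 0$$ has the following properties: the values $f(x_k)$ are nonincreasing and converge to $\inf f$; and if, furthermore, the desingularizer $\phi$ has moderate growth, then $$f(x_k)-\inf f\ =\ o\Big(\frac1k\Big)\quad\text{as } k\to\infty .$$
   Context: Let $(X,d)$ be a metric space and $f\colon X\to[-\infty,+\infty]$. The function $f$ is proper if it never takes the value $-\infty$ and its domain $\mathrm{dom}\,f=\{x: f(x)<+\infty\}$ is nonempty. Slope: at a point $x$ with $f(x)$ finite, $|\nabla f|(x)$ is the infimum of those $\epsilon>0$ for which $x$ is a local minimizer of $y\mapsto f(y)+\epsilon\, d(x,y)$ (with $\inf\emptyset=+\infty$); if $f(x)=+\infty$ then $|\nabla f|(x)=+\infty$. Limiting slope: for $\bar x\in\mathrm{dom}\,f$, $|\overline{\nabla} f|(\bar x)=\liminf_{x\to\bar x,\ f(x)\to f(\bar x)}|\nabla f|(x)$ (points $x=\bar x$ allowed), i.e. $\lim_{r\downarrow0}\inf\{|\nabla f|(x): d(x,\bar x)<r,\ |f(x)-f(\bar x)|<r\}$; it is taken to be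 $+\infty$ where $f=+\infty$. A desingularizer is a continuous function $\phi\colon[0,\infty)\to[0,\infty)$ with $\phi(0)=0$ that has a continuous, strictly positive derivative on $(0,+\infty)$ (with the convention $\phi(+\infty)=+\infty$). It has moderate growth if $\phi'(\tau)=o(1/\tau)$ as $\tau\downarrow0$. For $f$ lower semicontinuous, proper and bounded below, put $g=f-\inf f$ (the gap). $f$ has the Kurdyka-{\L}ojasiewicz (KL) property for minimization, with desingularizer $\phi$, if there exists $\rho>0$ such that $|\nabla(\phi\circ g)|(x)\ge1$ for all $x\in X$ with $0<g(x)<\rho$. *)

theory Defs
  imports "HOL-Analysis.Analysis" "HOL-Library.Landau_Symbols"
begin

definition proper :: "('a \<Rightarrow> ereal) \<Rightarrow> bool" where
  "proper f \<longleftrightarrow> (\<forall>x. f x \<noteq> -\<infinity>) \<and> (\<exists>x. f x < \<infinity>)"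

definition bounded_below :: "('a \<Rightarrow> ereal) \<Rightarrow> bool" where
  "bounded_below f \<longleftrightarrow> (\<exists>m::real. \<forall>x. ereal m \<le> f x)"

definition lower_semicontinuous :: "('a::topological_space \<Rightarrow> ereal) \<Rightarrow> bool" where
  "lower_semicontinuous f \<longleftrightarrow> (\<forall>x. f x \<le> Liminf (nhds x) f)"

definition local_minimizer :: "('a::topological_space \<Rightarrow> ereal) \<Rightarrow> 'a \<Rightarrow> bool" where
  "local_minimizer h x \<longleftrightarrow> (\<forall>\<^sub>F y in nhds x. h x \<le> h y)"

(* The infimum of the empty set in ereal is +oo.  The value at points where f = -oo
   is not meaningful; such points do not occur for proper f. *)
definition slope :: "('a::metric_space \<Rightarrow> ereal) \<Rightarrow> 'a \<Rightarrow> ereal" where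
  "slope f x =
     (if f x = \<infinity> then \<infinity>
      else Inf {ereal \<epsilon> | \<epsilon>::real. \<epsilon> > 0 \<and> local_minimizer (\<lambda>y. f y + ereal (\<epsilon> * dist x y)) x})"

(* The filter expresses "y tends to x and f y tends to f x"; since nhds x is not
   punctured, y = x is allowed. *)
definition limiting_slope :: "('a::metric_space \<Rightarrow> ereal) \<Rightarrow> 'a \<Rightarrow> ereal" where
  "limiting_slope f x =
     (if f x = \<infinity> then \<infinity>
      else Liminf (inf (nhds x) (filtercomap f (nhds (f x)))) (slope f))"

(* Functions on [0,oo) are modelled as functions on the reals; their values at negative
   arguments are never constrained or used. *)
definition desingularizer :: "(real \<Rightarrow> real) \<Rightarrow> bool" where
  "desingularizer \<phi> \<longleftrightarrow>
     continuous_on {0..} \<phi> \<and> \<phi> ` {0..} \<subseteq> {0..} \<and> \<phi> 0 = 0 \<and>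
     \<phi> differentiable_on {0<..} \<and> continuous_on {0<..} (deriv \<phi>) \<and> (\<forall>t>0. deriv \<phi> t > 0)"

definition moderate_growth :: "(real \<Rightarrow> real) \<Rightarrow> bool" where
  "moderate_growth \<phi> \<longleftrightarrow> deriv \<phi> \<in> o[at_right 0](\<lambda>\<tau>. 1 / \<tau>)"

(* The convention phi(+oo) = +oo. *)
definition extend_infinity :: "(real \<Rightarrow> real) \<Rightarrow> ereal \<Rightarrow> ereal" where
  "extend_infinity \<phi> t = (if t = \<infinity> then \<infinity> else ereal (\<phi> (real_of_ereal t)))"

definition gap :: "('a \<Rightarrow> ereal) \<Rightarrow> 'a \<Rightarrow> ereal" where
  "gap f x = f x - (INF y. f y)"

definition KL_minimization :: "('a::metric_space \<Rightarrow> ereal) \<Rightarrow> (real \<Rightarrow> real) \<Rightarrow> bool" where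
  "KL_minimization f \<phi> \<longleftrightarrow>
     desingularizer \<phi> \<and>
     (\<exists>\<rho>::real. \<rho> > 0 \<and>
        (\<forall>x. 0 < gap f x \<and> gap f x < ereal \<rho> \<longrightarrow> slope (extend_infinity \<phi> \<circ> gap f) x \<ge> 1))"

end

theory Submission
  imports Defs
begin

text \<open>Write \<open>g = f - inf f\<close>. Since \<open>\<phi>\<close> is increasing and differentiable, the KL property becomes
  \<open>slope f x \<ge> 1 / \<phi>' (g x)\<close>, and by continuity of \<open>\<phi>'\<close> the limiting slope obeys the same bound.
  The gaps \<open>h k = g (x k)\<close> therefore satisfy \<open>h k - h (k + 1) \<ge> \<delta> / (\<phi>' (h (k + 1)))\<^sup>2\<close>.
  A positive limit of \<open>h\<close> would bound these decrements away from zero, so \<open>h \<longlonglongrightarrow> 0\<close>. Under moderate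
  growth the decrements eventually exceed \<open>C * (h (k + 1))\<^sup>2\<close> for every constant \<open>C\<close>, so that
  \<open>1 / h\<close> eventually grows by at least \<open>C / 2\<close> in each step.\<close>

section \<open>Slopes and composition with a desingularizer\<close>

lemma desingularizer_DERIV:
  assumes "desingularizer \<phi>" "t > 0"
  shows "(\<phi> has_real_derivative deriv \<phi> t) (at t)"
proof -
  have "\<phi> differentiable (at t within {0<..})"
    using assms by (auto simp: desingularizer_def differentiable_on_def)
  then have "\<phi> differentiable (at t)"
    using assms(2) by (simp add: at_within_open[of t "{0<..}"])
  then show ?thesis
    by (simp add: DERIV_deriv_iff_real_differentiable)
qed

lemma desingularizer_mono:
  assumes "desingularizer \<phi>" "0 \<le> s" "s \<le> t"
  shows "\<phi> s \<le> \<phi> t"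
proof (cases "s = t")
  case False
  have "\<phi> s < \<phi> t"
  \<comment> \<open>Derivatives are required on the open interval only, which covers
    \<open>s = 0\<close>.\<close>
  proof (rule DERIV_pos_imp_increasing_open[where f = \<phi>])
    show "s < t" using False assms by simp
    show "\<exists>y. (\<phi> has_real_derivative y) (at u) \<and> 0 < y" if "s < u" "u < t" for u
      using desingularizer_DERIV[OF assms(1), of u] that assms
      by (auto simp: desingularizer_def)
    show "continuous_on {s..t} \<phi>"
      using assms by (auto simp: desingularizer_def intro: continuous_on_subset)
  qed
  then show ?thesis by simp
qed simp

text \<open>One half of a chain rule: were \<open>x\<close> a local minimizer of \<open>f\<close>
  plus \<open>e\<close> times the distance with \<open>e < 1 / deriv \<phi> \<tau>\<close>, applying
  the increasing \<open>\<phi>\<close> would make \<open>x\<close> a local minimizer of the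
  desingularized gap plus \<open>q\<close> times the distance for some \<open>q < 1\<close>,
  contradicting \<open>kl\<close>.\<close>

lemma slope_ge_of_slope_desingularized:
  fixes f :: "'a::metric_space \<Rightarrow> ereal"
  assumes des: "desingularizer \<phi>"
    and INF: "(INF y. f y) = ereal m"
    and fx: "f x = ereal (m + \<tau>)" and \<tau>: "\<tau> > 0"
    and kl: "slope (extend_infinity \<phi> \<circ> gap f) x \<ge> 1"
  shows "ereal (1 / deriv \<phi> \<tau>) \<le> slope f x"
proof -
  define D where "D = deriv \<phi> \<tau>"
  have D: "D > 0" using des \<tau> by (simp add: D_def desingularizer_def)
  have lower: "ereal m \<le> f y" for y
    using INF_lower[of y UNIV f] INF by simp
  have val: "(extend_infinity \<phi> \<circ> gap f) y = ereal (\<phi> t)" if "f y = ereal (m + t)" for y t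
    using that by (simp add: extend_infinity_def gap_def INF)
  have "1 / D \<le> e" if e: "e > 0" and
    lm: "local_minimizer (\<lambda>y. f y + ereal (e * dist x y)) x" for e
  proof (rule ccontr)
    assume "\<not> 1 / D \<le> e"
    then have "e * D < 1" using D by (simp add: field_simps)
    \<comment> \<open>The excess of \<open>q\<close> over \<open>e * D\<close> absorbs the
      first-order error of \<open>\<phi>\<close> at \<open>\<tau>\<close>.\<close>
    then obtain q where q: "e * D < q" "q < 1" using dense by blast
    have q0: "q > 0" using q D e by (smt (verit) mult_pos_pos)
    \<comment> \<open>With \<open>s = dist x y\<close>, local minimality forces the gap at
      \<open>y\<close> to be at least \<open>\<tau> - e * s\<close>, so \<open>\<psi> s\<close>
      bounds the perturbed desingularized gap at \<open>y\<close> from below, and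
      \<open>\<psi> 0\<close> is its value at \<open>x\<close>.\<close>
    define \<psi> where "\<psi> s = \<phi> (\<tau> - e * s) + q * s" for s
    have "(\<psi> has_real_derivative (q - e * D)) (at 0)"
    proof -
      have "(\<phi> has_real_derivative D) (at (\<tau> - e * 0))"
        using desingularizer_DERIV[OF des \<tau>] by (simp add: D_def)
      then have "((\<lambda>s. \<phi> (\<tau> - e * s)) has_real_derivative D * (- e)) (at 0)"
        by (rule DERIV_chain2) (auto intro!: derivative_eq_intros)
      then have "((\<lambda>s. \<phi> (\<tau> - e * s) + q * s) has_real_derivative D * (- e) + q) (at 0)"
        by (auto intro!: derivative_eq_intros)
      then show ?thesis by (simp add: \<psi>_def[abs_def] algebra_simps)
    qed
    then obtain d where d: "d > 0" "\<And>h. 0 < h \<Longrightarrow> h < d \<Longrightarrow> \<psi> 0 < \<psi> h"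
      using DERIV_pos_inc_right[of \<psi> "q - e * D" 0] q by auto
    \<comment> \<open>The bound \<open>\<tau> / e\<close> keeps \<open>\<tau> - e * s\<close>
      nonnegative, where \<open>\<phi>\<close> is monotone.\<close>
    define r where "r = min d (\<tau> / e)"
    have r: "r > 0" using d \<tau> e by (simp add: r_def)
    have near: "eventually (\<lambda>y. dist y x < r) (nhds x)"
      using r by (auto simp: eventually_nhds_metric)
    have "local_minimizer (\<lambda>y. (extend_infinity \<phi> \<circ> gap f) y + ereal (q * dist x y)) x"
      unfolding local_minimizer_def
      using near lm[unfolded local_minimizer_def]
    proof eventually_elim
      case (elim y)
      define s where "s = dist x y"
      have s: "0 \<le> s" "s < d" "s * e \<le> \<tau>"
        using elim(1) e by (auto simp: s_def r_def dist_commute field_simps)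
      show ?case
      proof (cases "f y = \<infinity>")
        case True
        then show ?thesis by (simp add: extend_infinity_def gap_def INF)
      next
        case False
        then obtain b where b: "f y = ereal b"
          using lower[of y] by (cases "f y") auto
        define t where "t = b - m"
        have t: "f y = ereal (m + t)" using b by (simp add: t_def)
        have t0: "t \<ge> 0" using lower[of y] t by simp
        have "t \<ge> \<tau> - e * s"
          using elim(2) t fx by (simp add: s_def)
        then have "\<phi> (\<tau> - e * s) \<le> \<phi> t"
          using s by (intro desingularizer_mono[OF des]) (auto simp: mult.commute)
        moreover have "\<psi> 0 \<le> \<psi> s"
          using d(2)[of s] s by (cases "s = 0") auto
        ultimately have "\<phi> \<tau> \<le> \<phi> t + q * s" by (simp add: \<psi>_def)
        then show ?thesis unfolding val[OF t] val[OF fx] by (simp add: s_def)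
      qed
    qed
    then have "slope (extend_infinity \<phi> \<circ> gap f) x \<le> ereal q"
      using q0 val[OF fx] by (auto simp: slope_def intro!: Inf_lower)
    with kl q show False
      by (metis ereal_less_eq(3) linorder_not_le one_ereal_def order.trans)
  qed
  then show ?thesis
    using fx by (auto simp: slope_def D_def intro!: Inf_greatest)
qed

text \<open>The lower bound for \<open>slope f y\<close> is a continuous function of the value
  \<open>f y\<close>, so it survives the limit inferior along points whose values tend to
  \<open>f x\<close>.\<close>

lemma limiting_slope_ge:
  fixes f :: "'a::metric_space \<Rightarrow> ereal"
  assumes des: "desingularizer \<phi>"
    and INF: "(INF y. f y) = ereal m"
    and kl: "\<And>x. 0 < gap f x \<Longrightarrow> gap f x < ereal \<rho> \<Longrightarrow> slope (extend_infinity \<phi> \<circ> gap f) x \<ge> 1"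
    and fx: "f x = ereal (m + \<tau>)" and \<tau>: "0 < \<tau>" "\<tau> < \<rho>"
  shows "ereal (1 / deriv \<phi> \<tau>) \<le> limiting_slope f x"
proof -
  have "\<forall>\<^sub>F y in inf (nhds x) (filtercomap f (nhds (f x))). c < slope f y"
    if c: "c < ereal (1 / deriv \<phi> \<tau>)" for c
  proof -
    have "isCont (deriv \<phi>) \<tau>"
      using des \<tau> by (auto simp: desingularizer_def continuous_on_eq_continuous_at)
    then have "isCont (\<lambda>b. deriv \<phi> (b - m)) (m + \<tau>)"
      by (intro isCont_o2[of _ "\<lambda>b. b - m" "deriv \<phi>"]) auto
    moreover have "deriv \<phi> \<tau> \<noteq> 0"
      using des \<tau> by (auto simp: desingularizer_def)
    ultimately have "isCont (\<lambda>b. 1 / deriv \<phi> (b - m)) (m + \<tau>)"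
      by (intro continuous_intros) auto
    then have "((\<lambda>b. ereal (1 / deriv \<phi> (b - m))) \<longlongrightarrow> ereal (1 / deriv \<phi> \<tau>)) (nhds (m + \<tau>))"
      using tendsto_at_iff_tendsto_nhds[of "\<lambda>b. 1 / deriv \<phi> (b - m)" "m + \<tau>"]
      by (intro tendsto_ereal) (simp add: isCont_def)
    then have 1: "\<forall>\<^sub>F b in nhds (m + \<tau>). c < ereal (1 / deriv \<phi> (b - m))"
      using c by (rule order_tendstoD)
    have 2: "\<forall>\<^sub>F b in nhds (m + \<tau>). b \<in> {m<..<m + \<rho>}"
      using \<tau> by (intro eventually_nhds_in_open) auto
    \<comment> \<open>Quantifying over all \<open>y\<close> at level \<open>b\<close> gives the form
      in which \<open>filtercomap\<close> carries the bound from values back to points.\<close>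
    have "\<forall>\<^sub>F b in nhds (m + \<tau>). \<forall>y. f y = ereal b \<longrightarrow> c < slope f y"
      using 1 2
    proof eventually_elim
      case (elim b)
      show ?case
      proof (intro allI impI)
        fix y assume y: "f y = ereal b"
        then have "gap f y = ereal (b - m)" by (simp add: gap_def INF)
        then have "ereal (1 / deriv \<phi> (b - m)) \<le> slope f y"
          using elim y by (intro slope_ge_of_slope_desingularized[OF des INF] kl) auto
        then show "c < slope f y" using elim(1) by simp
      qed
    qed
    then have "\<forall>\<^sub>F z in nhds (f x). \<forall>y. f y = z \<longrightarrow> c < slope f y"
      by (simp add: fx nhds_ereal eventually_filtermap)
    then have "\<forall>\<^sub>F y in filtercomap f (nhds (f x)). c < slope f y"
      by (auto simp: eventually_filtercomap)
    then show ?thesis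
      by (rule filter_leD[rotated]) simp
  qed
  then show ?thesis
    using fx by (simp add: limiting_slope_def le_Liminf_iff)
qed

lemma limiting_slope_nonneg: "0 \<le> limiting_slope f x"
proof -
  have "0 \<le> slope f y" for y
    by (auto simp: slope_def intro!: Inf_greatest)
  then show ?thesis
    by (auto simp: limiting_slope_def intro!: Liminf_bounded)
qed

section \<open>Real sequences with quadratic decrements\<close>

lemma inverse_growth_step:
  fixes u v c :: real
  assumes "0 \<le> v" "v \<le> u" "u - v \<ge> 2 * c * v\<^sup>2" "c \<ge> 0" "c * u \<le> 1" "c * n * u \<le> 1"
  shows "c * (n + 1) * v \<le> 1"
proof (cases "v = 0")
  case False
  with assms have v: "v > 0" and u: "u > 0" by auto
  have n: "c * n \<le> 1 / u" using assms(6) u by (simp add: field_simps)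
  have "c \<le> 1 / v - 1 / u"
  \<comment> \<open>If \<open>v\<close> is at most half of \<open>u\<close>, the reciprocal at least
    doubles and so gains \<open>1 / u\<close>, which is at least \<open>c\<close>. Otherwise
    \<open>u * v \<le> 2 * v * v\<close>, and dividing the decrement by \<open>u * v\<close> gives
    the gain; this is the origin of the factor 2 in the hypothesis.\<close>
  proof (cases "2 * v \<le> u")
    case True
    then have "1 / u + 1 / u \<le> 1 / v" using u v by (simp add: field_simps)
    moreover have "c \<le> 1 / u" using assms(5) u by (simp add: field_simps)
    ultimately show ?thesis by simp
  next
    case False
    have "c * (u * v) \<le> c * (2 * v * v)"
      using False assms v by (intro mult_left_mono mult_right_mono) auto
    also have "\<dots> \<le> u - v" using assms(3) by (simp add: power2_eq_square mult_ac)
    finally show ?thesis using u v by (simp add: field_simps)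
  qed
  with n have "c * (n + 1) \<le> 1 / v" by (simp add: algebra_simps)
  then show ?thesis using v by (simp add: field_simps)
qed simp

lemma smallo_inverse_of_quadratic_decrease:
  fixes h :: "nat \<Rightarrow> real"
  assumes nonneg: "\<And>k. 0 \<le> h k" and "decseq h" and lim: "h \<longlonglongrightarrow> 0"
    and dec: "\<And>C. C > 0 \<Longrightarrow> \<forall>\<^sub>F k in sequentially. h k - h (Suc k) \<ge> C * (h (Suc k))\<^sup>2"
  shows "h \<in> o(\<lambda>k. 1 / real k)"
proof (rule landau_o.smallI)
  fix e :: real assume e: "e > 0"
  \<comment> \<open>The 2 pays for replacing \<open>k - N\<close> by \<open>k\<close> at the end,
    where \<open>k \<ge> 2 * N + 1\<close> gives \<open>k \<le> 2 * (k - N)\<close>.\<close>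
  define c where "c = 2 / e"
  have c: "c > 0" using e by (simp add: c_def)
  have "\<forall>\<^sub>F k in sequentially. h k < 1 / c"
    using order_tendstoD(2)[OF lim] c by simp
  with dec[of "2 * c"] c
  have "\<forall>\<^sub>F k in sequentially. h k - h (Suc k) \<ge> 2 * c * (h (Suc k))\<^sup>2 \<and> h k < 1 / c"
    by (auto elim: eventually_elim2)
  then obtain N where N: "\<And>k. k \<ge> N \<Longrightarrow> h k - h (Suc k) \<ge> 2 * c * (h (Suc k))\<^sup>2"
      "\<And>k. k \<ge> N \<Longrightarrow> h k < 1 / c"
    by (auto simp: eventually_sequentially)
  have *: "c * real j * h (N + j) \<le> 1" for j
  proof (induction j)
    case (Suc j)
    have "c * (real j + 1) * h (Suc (N + j)) \<le> 1"
    proof (rule inverse_growth_step)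
      show "c * h (N + j) \<le> 1" using N(2)[of "N + j"] c by (simp add: field_simps)
    qed (use Suc N(1)[of "N + j"] nonneg \<open>decseq h\<close> c in \<open>auto simp: decseq_SucD\<close>)
    then show ?case by (simp add: add.commute)
  qed simp
  have "norm (h k) \<le> e * norm (1 / real k)" if k: "k \<ge> 2 * N + 1" for k
  proof -
    have "c * real k * h k \<le> c * (2 * real (k - N)) * h k"
      using k c nonneg by (intro mult_right_mono mult_left_mono) auto
    also have "\<dots> = 2 * (c * real (k - N) * h (N + (k - N)))" using k by simp
    also have "\<dots> \<le> 2" using *[of "k - N"] by linarith
    finally have "real k * h k \<le> e" using e by (simp add: c_def field_simps)
    then show ?thesis using k nonneg[of k] by (simp add: field_simps)
  qed
  then show "\<forall>\<^sub>F k in sequentially. norm (h k) \<le> e * norm (1 / real k)"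
    by (auto simp: eventually_sequentially)
qed

section \<open>Gap sequences along a descent\<close>

lemma descent_tendsto_zero:
  fixes h :: "nat \<Rightarrow> real"
  assumes des: "desingularizer \<phi>" and "\<delta> > 0"
    and nonneg: "\<And>k. 0 \<le> h k" and "decseq h"
    and dec: "\<And>k. h (Suc k) > 0 \<Longrightarrow> h k - h (Suc k) \<ge> \<delta> * (1 / deriv \<phi> (h (Suc k)))\<^sup>2"
  shows "h \<longlonglongrightarrow> 0"
proof -
  obtain L where L: "h \<longlonglongrightarrow> L" "\<And>k. L \<le> h k"
    using decseq_convergent[OF \<open>decseq h\<close>, of 0] nonneg by auto
  have "L \<ge> 0" using LIMSEQ_le_const[OF L(1)] nonneg by auto
  \<comment> \<open>All terms stay above \<open>L\<close>, so \<open>dec\<close> applies at every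
    index; its limit would read
    \<open>\<delta> * (1 / deriv \<phi> L)\<^sup>2 \<le> 0\<close>.\<close>
  moreover have False if "L > 0"
  proof -
    note hS = LIMSEQ_Suc[OF L(1)]
    have "isCont (deriv \<phi>) L"
      using des that by (auto simp: desingularizer_def continuous_on_eq_continuous_at)
    then have "(\<lambda>k. deriv \<phi> (h (Suc k))) \<longlonglongrightarrow> deriv \<phi> L"
      by (rule isCont_tendsto_compose[OF _ hS])
    moreover have pos: "deriv \<phi> L > 0" using des that by (auto simp: desingularizer_def)
    ultimately have "(\<lambda>k. \<delta> * (1 / deriv \<phi> (h (Suc k)))\<^sup>2) \<longlonglongrightarrow> \<delta> * (1 / deriv \<phi> L)\<^sup>2"
      by (intro tendsto_intros) auto
    moreover have "(\<lambda>k. h k - h (Suc k)) \<longlonglongrightarrow> L - L"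
      using L(1) hS by (rule tendsto_diff)
    moreover have "\<delta> * (1 / deriv \<phi> (h (Suc k)))\<^sup>2 \<le> h k - h (Suc k)" for k
      using dec[of k] L(2)[of "Suc k"] that by simp
    ultimately have "\<delta> * (1 / deriv \<phi> L)\<^sup>2 \<le> L - L"
      by (intro LIMSEQ_le) auto
    then show False using pos \<open>\<delta> > 0\<close> by (simp add: mult_le_0_iff)
  qed
  ultimately show ?thesis using L(1) by force
qed

lemma descent_moderate_growth:
  fixes h :: "nat \<Rightarrow> real"
  assumes des: "desingularizer \<phi>" and \<delta>: "\<delta> > 0" and mg: "moderate_growth \<phi>"
    and nonneg: "\<And>k. 0 \<le> h k" and "decseq h"
    and dec: "\<And>k. h (Suc k) > 0 \<Longrightarrow> h k - h (Suc k) \<ge> \<delta> * (1 / deriv \<phi> (h (Suc k)))\<^sup>2"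
  shows "h \<in> o(\<lambda>k. 1 / real k)"
proof (rule smallo_inverse_of_quadratic_decrease)
  show lim: "h \<longlonglongrightarrow> 0" by (rule descent_tendsto_zero) fact+
  fix C :: real assume C: "C > 0"
  \<comment> \<open>Chosen so that \<open>deriv \<phi> t \<le> \<eta> / t\<close> turns the
    decrement bound into exactly \<open>C * t\<^sup>2\<close>.\<close>
  define \<eta> where "\<eta> = sqrt (\<delta> / C)"
  have \<eta>: "\<eta> > 0" "\<eta>\<^sup>2 = \<delta> / C" using C \<delta> by (auto simp: \<eta>_def)
  have "\<forall>\<^sub>F t in at_right 0. norm (deriv \<phi> t) \<le> \<eta> * norm (1 / t)"
    using mg \<eta>(1) unfolding moderate_growth_def by (rule landau_o.smallD)
  then obtain b where b: "b > 0" "\<And>t. 0 < t \<Longrightarrow> t < b \<Longrightarrow> norm (deriv \<phi> t) \<le> \<eta> * norm (1 / t)"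
    by (auto simp: eventually_at_right_field)
  have "\<forall>\<^sub>F k in sequentially. h (Suc k) < b"
    using order_tendstoD(2)[OF LIMSEQ_Suc[OF lim] b(1)] .
  then show "\<forall>\<^sub>F k in sequentially. h k - h (Suc k) \<ge> C * (h (Suc k))\<^sup>2"
  proof eventually_elim
    case (elim k)
    show ?case
    proof (cases "h (Suc k) = 0")
      case True
      then show ?thesis using nonneg by simp
    next
      case False
      define t where "t = h (Suc k)"
      have t: "0 < t" using False nonneg[of "Suc k"] by (simp add: t_def)
      have D: "deriv \<phi> t > 0" using des t by (simp add: desingularizer_def)
      have "deriv \<phi> t \<le> \<eta> / t" using b(2)[of t] t D elim by (simp add: t_def)
      then have "t / \<eta> \<le> 1 / deriv \<phi> t" using D t \<eta>(1) by (simp add: field_simps)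
      then have "(t / \<eta>)\<^sup>2 \<le> (1 / deriv \<phi> t)\<^sup>2" using t \<eta>(1) by (intro power_mono) auto
      then have "\<delta> * (t / \<eta>)\<^sup>2 \<le> \<delta> * (1 / deriv \<phi> t)\<^sup>2" using \<delta> by simp
      moreover have "\<delta> * (t / \<eta>)\<^sup>2 = C * t\<^sup>2" using \<delta> C \<eta>(2) by (simp add: power_divide)
      ultimately show ?thesis using dec[of k] t by (simp add: t_def)
    qed
  qed
qed fact+

section \<open>Descent sequences in the metric space\<close>

theorem theorem3p2:
  fixes f :: "'a::metric_space \<Rightarrow> ereal"
    and \<phi> :: "real \<Rightarrow> real"
    and \<delta> :: real
  assumes "lower_semicontinuous f"
    and "proper f"
    and "bounded_below f"
    and "KL_minimization f \<phi>"
    and "\<delta> > 0"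
  shows "\<exists>\<epsilon>::real. \<epsilon> > 0 \<and>
    (\<forall>x :: nat \<Rightarrow> 'a.
       f (x 0) < (INF y. f y) + ereal \<epsilon> \<and>
       (\<forall>k. f (x k) - f (x (Suc k)) \<ge> ereal \<delta> * (limiting_slope f (x (Suc k)))\<^sup>2)
       \<longrightarrow>
       decseq (\<lambda>k. f (x k)) \<and>
       (\<lambda>k. f (x k)) \<longlonglongrightarrow> (INF y. f y) \<and>
       (moderate_growth \<phi> \<longrightarrow>
          (\<lambda>k. real_of_ereal (gap f (x k))) \<in> o(\<lambda>k. 1 / real k)))"
proof -
  obtain b where b: "\<And>y. ereal b \<le> f y"
    using assms(3) by (auto simp: bounded_below_def)
  obtain y0 where "f y0 < \<infinity>" using assms(2) by (auto simp: proper_def)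
  then have "(INF y. f y) < \<infinity>" using INF_lower[of y0 UNIV f] by (auto intro: le_less_trans)
  moreover have "ereal b \<le> (INF y. f y)" using b by (auto intro: INF_greatest)
  ultimately obtain m where INF: "(INF y. f y) = ereal m"
    by (cases "INF y. f y") auto
  have lower: "ereal m \<le> f y" for y
    using INF_lower[of y UNIV f] INF by simp
  obtain \<rho> where des: "desingularizer \<phi>" and \<rho>: "\<rho> > 0" and
    kl: "\<And>x. 0 < gap f x \<Longrightarrow> gap f x < ereal \<rho> \<Longrightarrow> slope (extend_infinity \<phi> \<circ> gap f) x \<ge> 1"
    using assms(4) by (auto simp: KL_minimization_def)
  have "decseq (\<lambda>k. f (x k)) \<and> (\<lambda>k. f (x k)) \<longlonglongrightarrow> (INF y. f y) \<and>
       (moderate_growth \<phi> \<longrightarrow> (\<lambda>k. real_of_ereal (gap f (x k))) \<in> o(\<lambda>k. 1 / real k))"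
    if init: "f (x 0) < (INF y. f y) + ereal \<rho>"
      and desc: "\<And>k. f (x k) - f (x (Suc k)) \<ge> ereal \<delta> * (limiting_slope f (x (Suc k)))\<^sup>2" for x
  proof -
    \<comment> \<open>Finiteness must propagate from \<open>x 0\<close>: from a finite value, a step
      to infinity would make the left side of \<open>desc\<close> minus infinity and the right side
      plus infinity, whereas in \<open>ereal\<close> infinity minus infinity is infinity and
      excludes nothing.\<close>
    have fin: "f (x k) \<noteq> \<infinity>" for k
    proof (induction k)
      case 0
      then show ?case using init INF by auto
    next
      case (Suc k)
      show ?case
      proof
        assume inf: "f (x (Suc k)) = \<infinity>"
        then have "limiting_slope f (x (Suc k)) = \<infinity>" by (simp add: limiting_slope_def)
        with desc[of k] inf Suc \<open>\<delta> > 0\<close> show False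
          by (cases "f (x k)") (auto simp: power2_eq_square)
      qed
    qed
    define h where "h k = real_of_ereal (gap f (x k))" for k
    have fh: "f (x k) = ereal (m + h k)" for k
      using fin[of k] lower[of "x k"] by (cases "f (x k)") (auto simp: h_def gap_def INF)
    have nonneg: "0 \<le> h k" for k using lower[of "x k"] fh[of k] by simp
    \<comment> \<open>A real minorant \<open>c\<close> avoids deciding whether the limiting slope is
      finite. Taking \<open>c = 0\<close> gives monotonicity, which keeps every gap below
      \<open>\<rho>\<close>; only then does the KL bound supply
      \<open>c = 1 / deriv \<phi> (h (Suc k))\<close>.\<close>
    have bound: "h k - h (Suc k) \<ge> \<delta> * c\<^sup>2"
      if "0 \<le> c" "ereal c \<le> limiting_slope f (x (Suc k))" for k c
    proof -
      have "ereal c * ereal c \<le> limiting_slope f (x (Suc k)) * limiting_slope f (x (Suc k))"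
        using that limiting_slope_nonneg by (intro ereal_mult_mono) auto
      then have "ereal \<delta> * ereal (c\<^sup>2) \<le> ereal \<delta> * (limiting_slope f (x (Suc k)))\<^sup>2"
        using \<open>\<delta> > 0\<close> by (intro ereal_mult_left_mono) (auto simp: power2_eq_square)
      also note desc[of k]
      finally show ?thesis by (simp add: fh)
    qed
    have "decseq h"
      using bound[of 0] limiting_slope_nonneg[of f] by (intro decseq_SucI) (simp add: zero_ereal_def)
    have "h 0 < \<rho>" using init by (simp add: INF fh)
    then have less: "h k < \<rho>" for k
      using decseqD[OF \<open>decseq h\<close>, of 0 k] by simp
    \<comment> \<open>The positivity guard reflects that the KL inequality says nothing at
      minimizers.\<close>
    have dec: "h k - h (Suc k) \<ge> \<delta> * (1 / deriv \<phi> (h (Suc k)))\<^sup>2" if "h (Suc k) > 0" for k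
      using that des less
      by (intro bound limiting_slope_ge[OF des INF kl fh]) (auto simp: desingularizer_def less_imp_le)
    have "decseq (\<lambda>k. f (x k))"
      using \<open>decseq h\<close> by (simp add: decseq_def fh)
    moreover have "h \<longlonglongrightarrow> 0"
      by (rule descent_tendsto_zero) fact+
    then have "(\<lambda>k. ereal (m + h k)) \<longlonglongrightarrow> ereal (m + 0)"
      by (intro tendsto_intros)
    then have "(\<lambda>k. f (x k)) \<longlonglongrightarrow> (INF y. f y)"
      by (simp add: fh INF)
    moreover have "h \<in> o(\<lambda>k. 1 / real k)" if "moderate_growth \<phi>"
      by (rule descent_moderate_growth) fact+
    ultimately show ?thesis by (simp add: h_def[abs_def])
  qed
  \<comment> \<open>The KL threshold \<open>\<rho>\<close> itself serves as the radius.\<close>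
  with \<rho> show ?thesis by (intro exI[of _ \<rho>]) blast
qed

end
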